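(* Let $p\in[1,\infty)$, let $\mathcal{X}$ be a separable Banach space over $\mathbb{K}$ (where $\mathbb{K}=\mathbb{R}$ or $\mathbb{C}$), and let $(\{f_n\}_n,\{\tau_n\}_n)$ be a p-approximate Schauder frame (p-ASF) for $\mathcal{X}$. Then there exist a Banach space $\mathcal{X}_1$ which contains $\mathcal{X}$ isometrically, a projection $P:\mathcal{X}_1\to\mathcal{X}$ of $\mathcal{X}_1$ onto $\mathcal{X}$, and a p-approximate Riesz basis $(\{g_n\}_n,\{\omega_n\}_n)$ for $\mathcal{X}_1$ such that $$f_n=g_nP_{|\mathcal{X}},\qquad \tau_n=P\omega_n,\qquad \forall n\in\mathbb{N}.$$
   Context: $\mathbb{K}=\mathbb{R}$ or $\mathbb{C}$; $\mathcal{X}^*$ denotes the (continuous) dual of a Banach space $\mathcal{X}$; sequences are indexed by $\mathbb{N}=\{1,2,\dots\}$; infinite series are understood as norm limits of partial sums; $I_{\ell^p(\mathbb{N})}$ is the identity operator on $\ell^p(\mathbb{N})$. Approximate Schauder frame (ASF): for a sequence $\{\tau_n\}_n$ in $\mathcal{X}$ and a sequence $\{f_n\}_n$ in $\mathcal{X}^*$, the pair $(\{f_n\}_n,\{\tau_n\}_n)$ is an ASF for $\mathcal{X}$ if the map $S_{f,\tau}:\mathcal{X}\ni x\mapsto \sum_{n=1}^\infty f_n(x)\tau_n\in\mathcal{X}$ is a well-defined bounded linear invertible operator. p-ASF ($p\in[1,\infty)$): an ASF $(\{f_n\}_n,\{\tau_n\}_n)$ for $\mathcal{X}$ such that both maps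 $$\theta_f:\mathcal{X}\ni x\mapsto \{f_n(x)\}_n\in\ell^p(\mathbb{N}),\qquad \theta_\tau:\ell^p(\mathbb{N})\ni\{a_n\}_n\mapsto\sum_{n=1}^\infty a_n\tau_n\in\mathcal{X}$$ are well-defined bounded linear operators. p-approximate Riesz basis: a pair $(\{f_n\}_n,\{\tau_n\}_n)$ is a p-approximate Riesz basis for $\mathcal{X}$ if it is a p-ASF for $\mathcal{X}$ and $\theta_fS_{f,\tau}^{-1}\theta_\tau=I_{\ell^p(\mathbb{N})}$. The same definitions apply to $\mathcal{X}_1$ and the pair $(\{g_n\}_n,\{\omega_n\}_n)$ with $g_n\in\mathcal{X}_1^*$, $\omega_n\in\mathcal{X}_1$. "$\mathcal{X}_1$ contains $\mathcal{X}$ isometrically" means there is a linear isometric embedding of $\mathcal{X}$ into $\mathcal{X}_1$, by which $\mathcal{X}$ is identified with a closed subspace of $\mathcal{X}_1$. A projection is a bounded linear idempotent operator; $P_{|\mathcal{X}}$ is the restriction of $P$ to $\mathcal{X}\subseteq\mathcal{X}_1$, and $g_nP_{|\mathcal{X}}$ is the composition $x\mapsto g_n(Px)$, $x\in\mathcal{X}$. *)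

theory Defs
  imports "HOL-Analysis.Analysis" "HOL-Library.Function_Algebras"
begin

text \<open>The embedding is only required to preserve addition, multiplication and absolute value;
  so the class consists of \<open>\<real>\<close> and \<open>\<complex>\<close>, up to isometric isomorphism of fields.\<close>

class real_or_complex = real_normed_field +
  assumes ex_isometric_iso_real_or_complex:
    "\<exists>h :: 'a \<Rightarrow> complex.
       (\<forall>x y. h (x + y) = h x + h y) \<and> (\<forall>x y. h (x * y) = h x * h y) \<and>
       (\<forall>x. norm (h x) = norm x) \<and> (range h = \<real> \<or> range h = UNIV)"

instance real :: real_or_complex
  by standard (rule exI[of _ complex_of_real], auto simp: Reals_def)

instance complex :: real_or_complex
  by standard (rule exI[of _ "\<lambda>z. z"], auto)

text \<open>A normed space is given by a linear subspace \<open>vecs\<close> of an ambient vector space (the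
  whole type, with its own addition and the scalar multiplication \<open>smul\<close>), and by a norm on
  \<open>vecs\<close>. The ambient space carries no topology and the values of \<open>nrm\<close> outside \<open>vecs\<close> are
  irrelevant. Explicit carriers are needed because the existence of a space cannot be stated
  by quantifying over types.\<close>

record ('k, 'v) nspace =
  vecs :: "'v set"
  smul :: "'k \<Rightarrow> 'v \<Rightarrow> 'v"
  nrm :: "'v \<Rightarrow> real"

definition normed_space :: "('k::real_or_complex, 'v::ab_group_add) nspace \<Rightarrow> bool" where
  "normed_space X \<longleftrightarrow>
     vector_space (smul X) \<and> module.subspace (smul X) (vecs X) \<and>
     (\<forall>x\<in>vecs X. 0 \<le> nrm X x) \<and>
     (\<forall>x\<in>vecs X. nrm X x = 0 \<longleftrightarrow> x = 0) \<and>
     (\<forall>c. \<forall>x\<in>vecs X. nrm X (smul X c x) = norm c * nrm X x) \<and>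
     (\<forall>x\<in>vecs X. \<forall>y\<in>vecs X. nrm X (x + y) \<le> nrm X x + nrm X y)"

text \<open>Distances are cut off outside the carrier since a metric must be globally nonnegative and
  symmetric.\<close>

definition norm_dist :: "('k, 'v::ab_group_add) nspace \<Rightarrow> 'v \<Rightarrow> 'v \<Rightarrow> real" where
  "norm_dist X x y = (if x \<in> vecs X \<and> y \<in> vecs X then nrm X (x - y) else 0)"

definition norm_metric :: "('k, 'v::ab_group_add) nspace \<Rightarrow> 'v metric" where
  "norm_metric X = metric (vecs X, norm_dist X)"

definition banach_space :: "('k::real_or_complex, 'v::ab_group_add) nspace \<Rightarrow> bool" where
  "banach_space X \<longleftrightarrow> normed_space X \<and> mcomplete_of (norm_metric X)"

definition separable_nspace :: "('k, 'v::ab_group_add) nspace \<Rightarrow> bool" where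
  "separable_nspace X \<longleftrightarrow> separable_space (mtopology_of (norm_metric X))"

lemma normed_space_diff:
  assumes "normed_space X" "x \<in> vecs X" "y \<in> vecs X"
  shows "x - y \<in> vecs X"
proof -
  interpret vector_space "smul X"
    using assms by (simp add: normed_space_def)
  show ?thesis
    using assms subspace_diff by (auto simp: normed_space_def)
qed

lemma Metric_space_norm_dist:
  assumes X: "normed_space X"
  shows "Metric_space (vecs X) (norm_dist X)"
proof -
  interpret vector_space "smul X"
    using X by (simp add: normed_space_def)
  have sub: "x - y \<in> vecs X" if "x \<in> vecs X" "y \<in> vecs X" for x y
    using normed_space_diff[OF X] that .
  have scale: "\<forall>c. \<forall>x\<in>vecs X. nrm X (smul X c x) = norm c * nrm X x"
    and add: "\<forall>x\<in>vecs X. \<forall>y\<in>vecs X. nrm X (x + y) \<le> nrm X x + nrm X y"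
    and zero: "\<forall>x\<in>vecs X. 0 \<le> nrm X x" "\<forall>x\<in>vecs X. nrm X x = 0 \<longleftrightarrow> x = 0"
    using X unfolding normed_space_def by simp_all
  have commute: "nrm X (x - y) = nrm X (y - x)" if "x \<in> vecs X" "y \<in> vecs X" for x y
  proof -
    have "nrm X (smul X (-1) (y - x)) = norm (-1 :: 'a) * nrm X (y - x)"
      using bspec[OF spec[OF scale] sub[OF that(2,1)]] .
    then show ?thesis by simp
  qed
  have tri: "nrm X (x - z) \<le> nrm X (x - y) + nrm X (y - z)"
    if "x \<in> vecs X" "y \<in> vecs X" "z \<in> vecs X" for x y z
  proof -
    have "nrm X ((x - y) + (y - z)) \<le> nrm X (x - y) + nrm X (y - z)"
      using bspec[OF bspec[OF add sub[OF that(1,2)]] sub[OF that(2,3)]] .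
    then show ?thesis by simp
  qed
  have pos: "0 \<le> nrm X (x - y)" "nrm X (x - y) = 0 \<longleftrightarrow> x = y"
    if "x \<in> vecs X" "y \<in> vecs X" for x y
    using bspec[OF zero(1) sub[OF that]] bspec[OF zero(2) sub[OF that]] by simp_all
  show ?thesis
  proof
    show "0 \<le> norm_dist X x y" for x y
      using pos(1) by (simp add: norm_dist_def)
    show "norm_dist X x y = norm_dist X y x" for x y
      using commute[of x y] by (simp add: norm_dist_def)
    show "norm_dist X x y = 0 \<longleftrightarrow> x = y" if "x \<in> vecs X" "y \<in> vecs X" for x y
      using pos(2)[OF that] that by (simp add: norm_dist_def)
    show "norm_dist X x z \<le> norm_dist X x y + norm_dist X y z"
      if "x \<in> vecs X" "y \<in> vecs X" "z \<in> vecs X" for x y z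
      using tri[OF that] that by (simp add: norm_dist_def)
  qed
qed

lemma limitin_norm_metric_iff:
  assumes "normed_space X" and "\<And>N. s N \<in> vecs X"
  shows "limitin (mtopology_of (norm_metric X)) s l sequentially \<longleftrightarrow>
           l \<in> vecs X \<and> (\<lambda>N. nrm X (s N - l)) \<longlonglongrightarrow> 0"
proof -
  interpret Metric_space "vecs X" "norm_dist X"
    using assms(1) by (rule Metric_space_norm_dist)
  have "mtopology_of (norm_metric X) = mtopology"
    by (simp add: norm_metric_def)
  moreover have "norm_dist X (s N) l = nrm X (s N - l)" if "l \<in> vecs X" for N
    using assms(2) that by (simp add: norm_dist_def)
  ultimately show ?thesis
    using assms(2) by (simp add: limitin_metric_dist_null cong: conj_cong)
qed

definition linear_op ::
  "('k, 'v::ab_group_add) nspace \<Rightarrow> ('k, 'w::ab_group_add) nspace \<Rightarrow> ('v \<Rightarrow> 'w) \<Rightarrow> bool" where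
  "linear_op X Y T \<longleftrightarrow>
     T ` vecs X \<subseteq> vecs Y \<and>
     (\<forall>x\<in>vecs X. \<forall>y\<in>vecs X. T (x + y) = T x + T y) \<and>
     (\<forall>c. \<forall>x\<in>vecs X. T (smul X c x) = smul Y c (T x))"

definition bounded_linear_op ::
  "('k, 'v::ab_group_add) nspace \<Rightarrow> ('k, 'w::ab_group_add) nspace \<Rightarrow> ('v \<Rightarrow> 'w) \<Rightarrow> bool" where
  "bounded_linear_op X Y T \<longleftrightarrow>
     linear_op X Y T \<and> (\<exists>C. \<forall>x\<in>vecs X. nrm Y (T x) \<le> C * nrm X x)"

definition inverse_op :: "('k, 'v) nspace \<Rightarrow> ('v \<Rightarrow> 'v) \<Rightarrow> 'v \<Rightarrow> 'v" where
  "inverse_op X T = inv_into (vecs X) T"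

definition bounded_invertible_op :: "('k, 'v::ab_group_add) nspace \<Rightarrow> ('v \<Rightarrow> 'v) \<Rightarrow> bool" where
  "bounded_invertible_op X T \<longleftrightarrow>
     bounded_linear_op X X T \<and> bij_betw T (vecs X) (vecs X) \<and>
     bounded_linear_op X X (inverse_op X T)"

definition isometric_embedding ::
  "('k, 'v::ab_group_add) nspace \<Rightarrow> ('k, 'w::ab_group_add) nspace \<Rightarrow> ('v \<Rightarrow> 'w) \<Rightarrow> bool" where
  "isometric_embedding X Y J \<longleftrightarrow> linear_op X Y J \<and> (\<forall>x\<in>vecs X. nrm Y (J x) = nrm X x)"

definition projection_onto ::
  "('k, 'v::ab_group_add) nspace \<Rightarrow> 'v set \<Rightarrow> ('v \<Rightarrow> 'v) \<Rightarrow> bool" where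
  "projection_onto Y M P \<longleftrightarrow>
     bounded_linear_op Y Y P \<and> (\<forall>y\<in>vecs Y. P (P y) = P y) \<and> P ` vecs Y = M"

definition scalars :: "('k::real_or_complex, 'k) nspace" where
  "scalars = \<lparr>vecs = UNIV, smul = (*), nrm = norm\<rparr>"

definition dual :: "('k::real_or_complex, 'v::ab_group_add) nspace \<Rightarrow> ('v \<Rightarrow> 'k) set" where
  "dual X = {\<phi>. bounded_linear_op X scalars \<phi>}"

definition lp :: "real \<Rightarrow> ('k::real_or_complex, nat \<Rightarrow> 'k) nspace" where
  "lp p = \<lparr>vecs = {a. summable (\<lambda>n. norm (a n) powr p)},
           smul = (\<lambda>c a n. c * a n),
           nrm = (\<lambda>a. (\<Sum>n. norm (a n) powr p) powr (1 / p))\<rparr>"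

definition series_to ::
  "('k, 'v::ab_group_add) nspace \<Rightarrow> (nat \<Rightarrow> 'v) \<Rightarrow> 'v \<Rightarrow> bool" where
  "series_to X u s \<longleftrightarrow>
     limitin (mtopology_of (norm_metric X)) (\<lambda>N. \<Sum>n<N. u n) s sequentially"

definition series_converges ::
  "('k, 'v::ab_group_add) nspace \<Rightarrow> (nat \<Rightarrow> 'v) \<Rightarrow> bool" where
  "series_converges X u \<longleftrightarrow> (\<exists>s. series_to X u s)"

definition series_sum :: "('k, 'v::ab_group_add) nspace \<Rightarrow> (nat \<Rightarrow> 'v) \<Rightarrow> 'v" where
  "series_sum X u = (THE s. series_to X u s)"

text \<open>Sequences are indexed from 0. Elements of the dual are functions on the whole ambient type
  of which only the values on the carrier matter.\<close>

definition frame_op ::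
  "('k, 'v::ab_group_add) nspace \<Rightarrow> (nat \<Rightarrow> 'v \<Rightarrow> 'k) \<Rightarrow> (nat \<Rightarrow> 'v) \<Rightarrow> 'v \<Rightarrow> 'v" where
  "frame_op X f \<tau> x = series_sum X (\<lambda>n. smul X (f n x) (\<tau> n))"

definition analysis_op :: "(nat \<Rightarrow> 'v \<Rightarrow> 'k) \<Rightarrow> 'v \<Rightarrow> nat \<Rightarrow> 'k" where
  "analysis_op f x = (\<lambda>n. f n x)"

definition synthesis_op ::
  "('k, 'v::ab_group_add) nspace \<Rightarrow> (nat \<Rightarrow> 'v) \<Rightarrow> (nat \<Rightarrow> 'k) \<Rightarrow> 'v" where
  "synthesis_op X \<tau> a = series_sum X (\<lambda>n. smul X (a n) (\<tau> n))"

definition ASF ::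
  "('k::real_or_complex, 'v::ab_group_add) nspace \<Rightarrow>
   (nat \<Rightarrow> 'v \<Rightarrow> 'k) \<Rightarrow> (nat \<Rightarrow> 'v) \<Rightarrow> bool" where
  "ASF X f \<tau> \<longleftrightarrow>
     (\<forall>n. f n \<in> dual X) \<and> (\<forall>n. \<tau> n \<in> vecs X) \<and>
     (\<forall>x\<in>vecs X. series_converges X (\<lambda>n. smul X (f n x) (\<tau> n))) \<and>
     bounded_invertible_op X (frame_op X f \<tau>)"

definition p_ASF ::
  "real \<Rightarrow> ('k::real_or_complex, 'v::ab_group_add) nspace \<Rightarrow>
   (nat \<Rightarrow> 'v \<Rightarrow> 'k) \<Rightarrow> (nat \<Rightarrow> 'v) \<Rightarrow> bool" where
  "p_ASF p X f \<tau> \<longleftrightarrow>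
     ASF X f \<tau> \<and>
     bounded_linear_op X (lp p) (analysis_op f) \<and>
     (\<forall>a\<in>vecs (lp p). series_converges X (\<lambda>n. smul X (a n) (\<tau> n))) \<and>
     bounded_linear_op (lp p) X (synthesis_op X \<tau>)"

definition p_approx_Riesz_basis ::
  "real \<Rightarrow> ('k::real_or_complex, 'v::ab_group_add) nspace \<Rightarrow>
   (nat \<Rightarrow> 'v \<Rightarrow> 'k) \<Rightarrow> (nat \<Rightarrow> 'v) \<Rightarrow> bool" where
  "p_approx_Riesz_basis p X f \<tau> \<longleftrightarrow>
     p_ASF p X f \<tau> \<and>
     (\<forall>a\<in>vecs (lp p).
        analysis_op f (inverse_op X (frame_op X f \<tau>) (synthesis_op X \<tau> a)) = a)"

end

theory Submission
  imports Defs
begin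

text \<open>Let \<open>\<theta>\<^sub>f : X \<rightarrow> \<ell>\<^sup>p\<close> be the analysis operator, \<open>\<theta>\<^sub>\<tau> : \<ell>\<^sup>p \<rightarrow> X\<close> the synthesis operator and
  \<open>S = \<theta>\<^sub>\<tau> \<theta>\<^sub>f\<close> the frame operator. Then \<open>Q = \<theta>\<^sub>f S\<^sup>-\<^sup>1 \<theta>\<^sub>\<tau>\<close> is a bounded projection of \<open>\<ell>\<^sup>p\<close> onto
  the range of \<open>\<theta>\<^sub>f\<close>, and its kernel is that of \<open>\<theta>\<^sub>\<tau>\<close>. The frame fails to be a Riesz basis
  exactly to the extent that \<open>Q\<close> differs from the identity, so the missing summand \<open>ker \<theta>\<^sub>\<tau>\<close> is added to the
  space: \<open>X\<^sub>1 = X \<oplus> ker \<theta>\<^sub>\<tau>\<close>, normed by the sum of the norms, which makes \<open>x \<mapsto> (x, 0)\<close> an isometry.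

  With \<open>g\<^sub>n (x, y) = f\<^sub>n x + y\<^sub>n\<close> and \<open>\<omega>\<^sub>n = (\<tau>\<^sub>n, (I - Q) e\<^sub>n)\<close> the new analysis operator is
  \<open>(x, y) \<mapsto> \<theta>\<^sub>f x + y\<close> and, because the unit vectors \<open>e\<^sub>n\<close> expand every sequence in \<open>\<ell>\<^sup>p\<close>, the new
  synthesis operator is \<open>a \<mapsto> (\<theta>\<^sub>\<tau> a, (I - Q) a)\<close>. Since \<open>Q\<close> fixes \<open>\<theta>\<^sub>f x\<close> and annihilates
  \<open>y\<close>, the new frame operator is \<open>(x, y) \<mapsto> (S x, y)\<close>, which is invertible (\<open>frame_op_X1\<close>); and
  analysis after its inverse after synthesis maps \<open>a\<close> to \<open>Q a + (I - Q) a = a\<close>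
  (\<open>p_approx_Riesz_basis_X1\<close>). The projection \<open>(x, y) \<mapsto> (x, 0)\<close> sends \<open>\<omega>\<^sub>n\<close> to \<open>(\<tau>\<^sub>n, 0)\<close>.

  What remains is analytic: \<open>\<ell>\<^sup>p\<close> is a Banach space (\<open>banach_space_lp\<close>, resting on
  \<open>Minkowski\<close>), and completeness passes to kernels of bounded operators and to direct sums, so
  that \<open>X\<^sub>1\<close> is a Banach space too.\<close>

section \<open>Normed spaces with explicit carriers\<close>

locale carrier_normed_space =
  fixes X :: "('k::real_or_complex, 'v::ab_group_add) nspace"
  assumes normed: "normed_space X"
begin

sublocale vector_space "smul X"
  using normed by (simp add: normed_space_def)

lemma subspace_vecs: "subspace (vecs X)"
  using normed by (simp add: normed_space_def)

lemma zero_vecs [simp]: "0 \<in> vecs X"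
  and add_vecs [simp]: "\<And>x y. x \<in> vecs X \<Longrightarrow> y \<in> vecs X \<Longrightarrow> x + y \<in> vecs X"
  and diff_vecs [simp]: "\<And>x y. x \<in> vecs X \<Longrightarrow> y \<in> vecs X \<Longrightarrow> x - y \<in> vecs X"
  and minus_vecs [simp]: "\<And>x. x \<in> vecs X \<Longrightarrow> - x \<in> vecs X"
  and smul_vecs [simp]: "\<And>c x. x \<in> vecs X \<Longrightarrow> smul X c x \<in> vecs X"
  and sum_vecs: "\<And>A u. (\<And>i. i \<in> A \<Longrightarrow> u i \<in> vecs X) \<Longrightarrow> sum u A \<in> vecs X"
  using subspace_vecs
  by (auto intro: subspace_0 subspace_add subspace_diff subspace_neg subspace_scale subspace_sum)

lemma nrm_nonneg [simp]: "x \<in> vecs X \<Longrightarrow> 0 \<le> nrm X x"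
  and nrm_eq_0_iff [simp]: "x \<in> vecs X \<Longrightarrow> nrm X x = 0 \<longleftrightarrow> x = 0"
  and nrm_smul: "x \<in> vecs X \<Longrightarrow> nrm X (smul X c x) = norm c * nrm X x"
  and nrm_triangle: "x \<in> vecs X \<Longrightarrow> y \<in> vecs X \<Longrightarrow> nrm X (x + y) \<le> nrm X x + nrm X y"
  using normed by (simp_all add: normed_space_def)

lemma nrm_zero [simp]: "nrm X 0 = 0"
  by simp

lemma nrm_minus_commute:
  assumes "x \<in> vecs X" "y \<in> vecs X"
  shows "nrm X (x - y) = nrm X (y - x)"
  using nrm_smul[of "y - x" "-1"] assms by simp

lemma nrm_limit_unique:
  assumes s: "\<And>n. s n \<in> vecs X" and ab: "a \<in> vecs X" "b \<in> vecs X"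
    and lim: "(\<lambda>n. nrm X (s n - a)) \<longlonglongrightarrow> 0" "(\<lambda>n. nrm X (s n - b)) \<longlonglongrightarrow> 0"
  shows "a = b"
proof -
  have "nrm X (a - b) \<le> nrm X (s n - a) + nrm X (s n - b)" for n
    using nrm_triangle[of "a - s n" "s n - b"] nrm_minus_commute[of a "s n"] s ab by simp
  then have "nrm X (a - b) \<le> 0"
    using LIMSEQ_le_const[OF tendsto_add[OF lim], of "nrm X (a - b)"] by auto
  with nrm_nonneg[OF diff_vecs[OF ab]] have "nrm X (a - b) = 0"
    by (rule order_antisym[rotated])
  then show ?thesis
    using nrm_eq_0_iff[of "a - b"] ab by simp
qed

lemma series_to_iff:
  assumes "\<And>n. u n \<in> vecs X"
  shows "series_to X u s \<longleftrightarrow> s \<in> vecs X \<and> (\<lambda>N. nrm X ((\<Sum>n<N. u n) - s)) \<longlonglongrightarrow> 0"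
  unfolding series_to_def using assms by (intro limitin_norm_metric_iff normed sum_vecs)

lemma series_sum_eqI:
  assumes "\<And>n. u n \<in> vecs X" and "series_to X u s"
  shows "series_sum X u = s"
  unfolding series_sum_def
proof (rule the_equality[of "series_to X u"])
  show "t = s" if "series_to X u t" for t
    using that assms series_to_iff[OF assms(1)]
    by (intro nrm_limit_unique[of "\<lambda>N. \<Sum>n<N. u n"]) (auto intro: sum_vecs)
qed (use assms in simp)

lemma series_to_series_sum:
  assumes "\<And>n. u n \<in> vecs X" and "series_converges X u"
  shows "series_to X u (series_sum X u)"
  using assms series_sum_eqI by (metis series_converges_def)

lemma banach_space_iff:
  "banach_space X \<longleftrightarrow>
     (\<forall>s. (\<forall>n. s n \<in> vecs X) \<longrightarrow> (\<forall>e>0. \<exists>N. \<forall>m\<ge>N. \<forall>n\<ge>N. nrm X (s m - s n) < e) \<longrightarrow>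
        (\<exists>l\<in>vecs X. (\<lambda>n. nrm X (s n - l)) \<longlonglongrightarrow> 0))"
proof -
  interpret M: Metric_space "vecs X" "norm_dist X"
    using normed by (rule Metric_space_norm_dist)
  have top: "M.mtopology = mtopology_of (norm_metric X)"
    by (simp add: norm_metric_def)
  have "banach_space X \<longleftrightarrow> M.mcomplete"
    by (simp add: banach_space_def normed norm_metric_def mcomplete_of_def)
  also have "\<dots> \<longleftrightarrow>
     (\<forall>s. (\<forall>n. s n \<in> vecs X) \<longrightarrow> (\<forall>e>0. \<exists>N. \<forall>m\<ge>N. \<forall>n\<ge>N. nrm X (s m - s n) < e) \<longrightarrow>
        (\<exists>l\<in>vecs X. (\<lambda>n. nrm X (s n - l)) \<longlonglongrightarrow> 0))"
    (is "_ \<longleftrightarrow> (\<forall>s. ?in s \<longrightarrow> ?cauchy s \<longrightarrow> ?lim s)")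
  proof -
    have c: "M.MCauchy s \<longleftrightarrow> ?in s \<and> ?cauchy s" for s
      unfolding M.MCauchy_def norm_dist_def
      by (auto simp: image_subset_iff)
    have l: "?in s \<Longrightarrow> (\<exists>x. limitin M.mtopology s x sequentially) \<longleftrightarrow> ?lim s" for s
      unfolding top using limitin_norm_metric_iff[OF normed, of s] by auto
    show ?thesis
      unfolding M.mcomplete_def using c l by blast
  qed
  finally show ?thesis .
qed

lemma banach_space_cauchyE:
  assumes "banach_space X" and "\<And>n. s n \<in> vecs X"
    and "\<And>e. 0 < e \<Longrightarrow> \<exists>N. \<forall>m\<ge>N. \<forall>n\<ge>N. nrm X (s m - s n) < e"
  obtains l where "l \<in> vecs X" "(\<lambda>n. nrm X (s n - l)) \<longlonglongrightarrow> 0"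
proof -
  have "\<exists>l\<in>vecs X. (\<lambda>n. nrm X (s n - l)) \<longlonglongrightarrow> 0"
    using assms(1) unfolding banach_space_iff by (elim allE[of _ s] impE) (use assms in simp_all)
  then show ?thesis
    using that by blast
qed

end

section \<open>Bounded linear operators\<close>

lemma linear_opD:
  assumes "linear_op X Y T"
  shows "x \<in> vecs X \<Longrightarrow> T x \<in> vecs Y"
    and "x \<in> vecs X \<Longrightarrow> y \<in> vecs X \<Longrightarrow> T (x + y) = T x + T y"
    and "x \<in> vecs X \<Longrightarrow> T (smul X c x) = smul Y c (T x)"
  using assms by (auto simp: linear_op_def)

lemma linear_op_diff:
  assumes "normed_space X" and T: "linear_op X Y T" and "x \<in> vecs X" "y \<in> vecs X"
  shows "T (x - y) = T x - T y"
proof -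
  interpret carrier_normed_space X using assms by unfold_locales
  show ?thesis
    using linear_opD(2)[OF T, of "x - y" y] assms by simp
qed

lemma linear_op_zero:
  assumes "normed_space X" and T: "linear_op X Y T"
  shows "T 0 = 0"
proof -
  interpret carrier_normed_space X using assms by unfold_locales
  show ?thesis
    using linear_op_diff[OF assms, of 0 0] by simp
qed

lemma linear_op_sum:
  assumes "normed_space X" and T: "linear_op X Y T" and u: "\<And>n. u n \<in> vecs X"
  shows "T (\<Sum>n<(N::nat). u n) = (\<Sum>n<N. T (u n))"
proof -
  interpret carrier_normed_space X using assms by unfold_locales
  show ?thesis
    by (induction N) (simp_all add: linear_op_zero[OF assms(1,2)] linear_opD(2)[OF T] u sum_vecs)
qed

lemma bounded_linear_op_linear: "bounded_linear_op X Y T \<Longrightarrow> linear_op X Y T"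
  by (simp add: bounded_linear_op_def)

lemma bounded_linear_opI:
  assumes "linear_op X Y T" and "\<And>x. x \<in> vecs X \<Longrightarrow> nrm Y (T x) \<le> C * nrm X x"
  shows "bounded_linear_op X Y T"
  using assms by (auto simp: bounded_linear_op_def)

lemma bounded_linear_op_nonneg_bound:
  assumes "normed_space X" and "bounded_linear_op X Y T"
  obtains C where "0 \<le> C" and "\<And>x. x \<in> vecs X \<Longrightarrow> nrm Y (T x) \<le> C * nrm X x"
proof -
  interpret carrier_normed_space X using assms by unfold_locales
  obtain C where C: "\<And>x. x \<in> vecs X \<Longrightarrow> nrm Y (T x) \<le> C * nrm X x"
    using assms by (auto simp: bounded_linear_op_def)
  have "nrm Y (T x) \<le> max C 0 * nrm X x" if "x \<in> vecs X" for x
    using C[OF that] mult_right_mono[of C "max C 0" "nrm X x"] that by simp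
  then show ?thesis
    using that[of "max C 0"] by simp
qed

lemma bounded_linear_op_cong:
  assumes "normed_space X" and eq: "\<And>x. x \<in> vecs X \<Longrightarrow> T x = U x" and T: "bounded_linear_op X Y T"
  shows "bounded_linear_op X Y U"
proof -
  interpret carrier_normed_space X using assms by unfold_locales
  show ?thesis
    using T by (auto simp: bounded_linear_op_def linear_op_def image_subset_iff simp flip: eq)
qed

lemma bounded_linear_op_compose:
  assumes X: "normed_space X" and Y: "normed_space Y"
    and T: "bounded_linear_op X Y T" and U: "bounded_linear_op Y Z U"
  shows "bounded_linear_op X Z (\<lambda>x. U (T x))"
proof -
  note T' = linear_opD[OF bounded_linear_op_linear[OF T]]
  note U' = linear_opD[OF bounded_linear_op_linear[OF U]]
  obtain C where C: "0 \<le> C" "\<And>x. x \<in> vecs X \<Longrightarrow> nrm Y (T x) \<le> C * nrm X x"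
    using bounded_linear_op_nonneg_bound[OF X T] by metis
  obtain D where D: "0 \<le> D" "\<And>x. x \<in> vecs Y \<Longrightarrow> nrm Z (U x) \<le> D * nrm Y x"
    using bounded_linear_op_nonneg_bound[OF Y U] by metis
  show ?thesis
  proof (rule bounded_linear_opI)
    show "linear_op X Z (\<lambda>x. U (T x))"
      using T' U' by (auto simp: linear_op_def)
    show "nrm Z (U (T x)) \<le> (D * C) * nrm X x" if "x \<in> vecs X" for x
      using D(2)[OF T'(1)[OF that]] mult_left_mono[OF C(2)[OF that] D(1)] by simp
  qed
qed

lemma bounded_linear_op_add:
  assumes X: "normed_space X" and Y: "normed_space Y"
    and T: "bounded_linear_op X Y T" and U: "bounded_linear_op X Y U"
  shows "bounded_linear_op X Y (\<lambda>x. T x + U x)"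
proof -
  interpret Y: carrier_normed_space Y using Y by unfold_locales
  note T' = linear_opD[OF bounded_linear_op_linear[OF T]]
  note U' = linear_opD[OF bounded_linear_op_linear[OF U]]
  obtain C where C: "\<And>x. x \<in> vecs X \<Longrightarrow> nrm Y (T x) \<le> C * nrm X x"
    using bounded_linear_op_nonneg_bound[OF X T] by metis
  obtain D where D: "\<And>x. x \<in> vecs X \<Longrightarrow> nrm Y (U x) \<le> D * nrm X x"
    using bounded_linear_op_nonneg_bound[OF X U] by metis
  show ?thesis
  proof (rule bounded_linear_opI)
    show "linear_op X Y (\<lambda>x. T x + U x)"
      using T' U' by (auto simp: linear_op_def Y.scale_right_distrib)
    show "nrm Y (T x + U x) \<le> (C + D) * nrm X x" if "x \<in> vecs X" for x
      using Y.nrm_triangle[OF T'(1)[OF that] U'(1)[OF that]] C[OF that] D[OF that]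
      by (simp add: distrib_right)
  qed
qed

lemma bounded_linear_op_diff:
  assumes X: "normed_space X" and Y: "normed_space Y"
    and T: "bounded_linear_op X Y T" and U: "bounded_linear_op X Y U"
  shows "bounded_linear_op X Y (\<lambda>x. T x - U x)"
proof -
  interpret Y: carrier_normed_space Y using Y by unfold_locales
  have "linear_op Y Y uminus"
    by (auto simp: linear_op_def)
  then have "bounded_linear_op Y Y uminus"
    by (rule bounded_linear_opI[where C = 1]) (use Y.nrm_minus_commute[of 0] in auto)
  from bounded_linear_op_add[OF X Y T bounded_linear_op_compose[OF X Y U this]]
  show ?thesis by simp
qed

lemma bounded_linear_op_id:
  "bounded_linear_op X X (\<lambda>x. x)"
  by (rule bounded_linear_opI[where C = 1]) (auto simp: linear_op_def)

lemma bounded_linear_op_tendsto: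
  assumes X: "normed_space X" and Y: "normed_space Y" and T: "bounded_linear_op X Y T"
    and s: "\<And>n. s n \<in> vecs X" and l: "l \<in> vecs X"
    and lim: "(\<lambda>n. nrm X (s n - l)) \<longlonglongrightarrow> 0"
  shows "(\<lambda>n. nrm Y (T (s n) - T l)) \<longlonglongrightarrow> 0"
proof -
  interpret X: carrier_normed_space X using X by unfold_locales
  interpret Y: carrier_normed_space Y using Y by unfold_locales
  note lin = bounded_linear_op_linear[OF T]
  obtain C where C: "\<And>x. x \<in> vecs X \<Longrightarrow> nrm Y (T x) \<le> C * nrm X x"
    using bounded_linear_op_nonneg_bound[OF X T] by metis
  have lim_C: "(\<lambda>n. C * nrm X (s n - l)) \<longlonglongrightarrow> 0"
    using tendsto_mult_right_zero[OF lim] .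
  have le: "nrm Y (T (s n) - T l) \<le> C * nrm X (s n - l)" for n
    using C[of "s n - l"] s l by (simp add: linear_op_diff[OF X lin])
  have "0 \<le> nrm Y (T (s n) - T l)" for n
    using linear_opD(1)[OF lin] s l by simp
  then show ?thesis
    by (intro real_tendsto_sandwich[OF _ _ tendsto_const lim_C] always_eventually allI le)
qed

text \<open>A linear operator commutes with the partial sums, and a bounded one with their limit.\<close>

lemma series_to_bounded_linear_op:
  assumes X: "normed_space X" and Y: "normed_space Y" and T: "bounded_linear_op X Y T"
    and u: "\<And>n. u n \<in> vecs X" and "series_to X u s"
  shows "series_to Y (\<lambda>n. T (u n)) (T s)"
proof -
  interpret X: carrier_normed_space X using X by unfold_locales
  interpret Y: carrier_normed_space Y using Y by unfold_locales
  note lin = bounded_linear_op_linear[OF T]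
  have s: "s \<in> vecs X" "(\<lambda>N. nrm X ((\<Sum>n<N. u n) - s)) \<longlonglongrightarrow> 0"
    using assms(5) by (simp_all add: X.series_to_iff u)
  have "(\<lambda>N. nrm Y (T (\<Sum>n<N. u n) - T s)) \<longlonglongrightarrow> 0"
    using s by (intro bounded_linear_op_tendsto[OF X Y T] X.sum_vecs u)
  then show ?thesis
    using s(1) by (simp add: Y.series_to_iff u linear_opD(1)[OF lin] linear_op_sum[OF X lin])
qed

section \<open>Kernels and direct sums\<close>

definition kernel_nspace ::
  "('k, 'v) nspace \<Rightarrow> ('v \<Rightarrow> 'w::zero) \<Rightarrow> ('k, 'v) nspace" where
  "kernel_nspace X T = X\<lparr>vecs := {x \<in> vecs X. T x = 0}\<rparr>"

lemma kernel_nspace_simps [simp]: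
  "vecs (kernel_nspace X T) = {x \<in> vecs X. T x = 0}"
  "smul (kernel_nspace X T) = smul X"
  "nrm (kernel_nspace X T) = nrm X"
  by (simp_all add: kernel_nspace_def)

lemma normed_space_kernel:
  assumes X: "normed_space X" and Y: "normed_space Y" and T: "linear_op X Y T"
  shows "normed_space (kernel_nspace X T)"
proof -
  interpret X: carrier_normed_space X using X by unfold_locales
  interpret Y: carrier_normed_space Y using Y by unfold_locales
  have "X.subspace {x \<in> vecs X. T x = 0}"
    by (rule X.subspaceI) (auto simp: linear_op_zero[OF X T] linear_opD[OF T])
  then show ?thesis
    using X by (simp add: normed_space_def)
qed

text \<open>A Cauchy sequence in the kernel converges in the whole space, and by continuity of the operator
  its limit stays in the kernel.\<close>

lemma banach_space_kernel:
  assumes X: "banach_space X" and Y: "normed_space Y" and T: "bounded_linear_op X Y T"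
  shows "banach_space (kernel_nspace X T)"
proof -
  have nX: "normed_space X"
    using X by (simp add: banach_space_def)
  interpret X: carrier_normed_space X using nX by unfold_locales
  interpret Y: carrier_normed_space Y using Y by unfold_locales
  note lin = bounded_linear_op_linear[OF T]
  interpret K: carrier_normed_space "kernel_nspace X T"
    by unfold_locales (rule normed_space_kernel[OF nX Y lin])
  show ?thesis
    unfolding K.banach_space_iff
  proof (intro allI impI)
    fix s :: "nat \<Rightarrow> _" assume s: "\<forall>n. s n \<in> vecs (kernel_nspace X T)"
      and c: "\<forall>e>0. \<exists>N. \<forall>m\<ge>N. \<forall>n\<ge>N. nrm (kernel_nspace X T) (s m - s n) < e"
    obtain l where l: "l \<in> vecs X" "(\<lambda>n. nrm X (s n - l)) \<longlonglongrightarrow> 0"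
      by (rule X.banach_space_cauchyE[OF X, of s]) (use s c in auto)
    have "(\<lambda>n. nrm Y (T (s n) - T l)) \<longlonglongrightarrow> 0"
      using s l by (intro bounded_linear_op_tendsto[OF nX Y T]) auto
    then have "(\<lambda>n. nrm Y (0 - T l)) \<longlonglongrightarrow> 0"
      using s by simp
    then have "T l = 0"
      using Y.nrm_limit_unique[of "\<lambda>_. 0" "T l" 0] linear_opD(1)[OF lin l(1)] by simp
    then show "\<exists>l\<in>vecs (kernel_nspace X T). (\<lambda>n. nrm (kernel_nspace X T) (s n - l)) \<longlonglongrightarrow> 0"
      using l by auto
  qed
qed

lemma bounded_linear_op_into_kernel:
  assumes "bounded_linear_op Z X U" and "\<And>z. z \<in> vecs Z \<Longrightarrow> T (U z) = 0"
  shows "bounded_linear_op Z (kernel_nspace X T) U"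
  using assms by (auto simp: bounded_linear_op_def linear_op_def)

lemma bounded_linear_op_kernel_inclusion:
  "bounded_linear_op (kernel_nspace X T) X (\<lambda>x. x)"
  by (rule bounded_linear_opI[where C = 1]) (auto simp: linear_op_def)

text \<open>Among the equivalent norms on the product the sum is chosen: the inclusion of each summand is
  isometric, and operator bounds for the components simply add up.\<close>

definition direct_sum ::
  "('k, 'v) nspace \<Rightarrow> ('k, 'w) nspace \<Rightarrow> ('k, 'v \<times> 'w) nspace" where
  "direct_sum X Y =
     \<lparr>vecs = vecs X \<times> vecs Y,
      smul = (\<lambda>c z. (smul X c (fst z), smul Y c (snd z))),
      nrm = (\<lambda>z. nrm X (fst z) + nrm Y (snd z))\<rparr>"

lemma direct_sum_simps [simp]:
  "vecs (direct_sum X Y) = vecs X \<times> vecs Y"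
  "smul (direct_sum X Y) c z = (smul X c (fst z), smul Y c (snd z))"
  "nrm (direct_sum X Y) z = nrm X (fst z) + nrm Y (snd z)"
  by (simp_all add: direct_sum_def)

lemma normed_space_direct_sum:
  assumes X: "normed_space X" and Y: "normed_space Y"
  shows "normed_space (direct_sum X Y)"
proof -
  interpret X: carrier_normed_space X using X by unfold_locales
  interpret Y: carrier_normed_space Y using Y by unfold_locales
  have V: "vector_space (smul (direct_sum X Y))"
    unfolding vector_space_def
    by (simp add: X.scale_right_distrib Y.scale_right_distrib X.scale_left_distrib
        Y.scale_left_distrib)
  then interpret V: vector_space "smul (direct_sum X Y)" .
  have "V.subspace (vecs (direct_sum X Y))"
    by (rule V.subspaceI) (simp_all add: mem_Times_iff)
  moreover have "nrm X (fst x) + nrm Y (snd x) = 0 \<longleftrightarrow> x = 0"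
    if "x \<in> vecs X \<times> vecs Y" for x
  proof -
    have x: "fst x \<in> vecs X" "snd x \<in> vecs Y"
      using that by auto
    show ?thesis
      using X.nrm_nonneg[OF x(1)] Y.nrm_nonneg[OF x(2)]
      by (simp add: add_nonneg_eq_0_iff x prod_eq_iff)
  qed
  moreover have "nrm X (fst (x + y)) + nrm Y (snd (x + y)) \<le>
      (nrm X (fst x) + nrm Y (snd x)) + (nrm X (fst y) + nrm Y (snd y))"
    if "x \<in> vecs X \<times> vecs Y" "y \<in> vecs X \<times> vecs Y" for x y
    using that X.nrm_triangle[of "fst x" "fst y"] Y.nrm_triangle[of "snd x" "snd y"]
    by (simp add: mem_Times_iff)
  ultimately show ?thesis
    unfolding normed_space_def using V
    by (simp add: mem_Times_iff X.nrm_smul Y.nrm_smul distrib_left)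
qed

lemma banach_space_direct_sum:
  assumes X: "banach_space X" and Y: "banach_space Y"
  shows "banach_space (direct_sum X Y)"
proof -
  have nX: "normed_space X" and nY: "normed_space Y"
    using X Y by (simp_all add: banach_space_def)
  interpret X: carrier_normed_space X using nX by unfold_locales
  interpret Y: carrier_normed_space Y using nY by unfold_locales
  interpret S: carrier_normed_space "direct_sum X Y"
    by unfold_locales (rule normed_space_direct_sum[OF nX nY])
  show ?thesis
    unfolding S.banach_space_iff
  proof (intro allI impI)
    fix s :: "nat \<Rightarrow> _" assume s: "\<forall>n. s n \<in> vecs (direct_sum X Y)"
      and c: "\<forall>e>0. \<exists>N. \<forall>m\<ge>N. \<forall>n\<ge>N. nrm (direct_sum X Y) (s m - s n) < e"
    have in_X: "fst (s n) \<in> vecs X" and in_Y: "snd (s n) \<in> vecs Y" for n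
      using s by (auto simp: mem_Times_iff)
    have le: "nrm X (fst (s m) - fst (s n)) \<le> nrm (direct_sum X Y) (s m - s n)"
      "nrm Y (snd (s m) - snd (s n)) \<le> nrm (direct_sum X Y) (s m - s n)" for m n
      using in_X in_Y by simp_all
    obtain a where a: "a \<in> vecs X" "(\<lambda>n. nrm X (fst (s n) - a)) \<longlonglongrightarrow> 0"
    proof (rule X.banach_space_cauchyE[OF X in_X])
      show "\<exists>N. \<forall>m\<ge>N. \<forall>n\<ge>N. nrm X (fst (s m) - fst (s n)) < e" if "0 < e" for e
        using c[rule_format, OF that] le_less_trans[OF le(1)] by blast
    qed
    obtain b where b: "b \<in> vecs Y" "(\<lambda>n. nrm Y (snd (s n) - b)) \<longlonglongrightarrow> 0"
    proof (rule Y.banach_space_cauchyE[OF Y in_Y])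
      show "\<exists>N. \<forall>m\<ge>N. \<forall>n\<ge>N. nrm Y (snd (s m) - snd (s n)) < e" if "0 < e" for e
        using c[rule_format, OF that] le_less_trans[OF le(2)] by blast
    qed
    show "\<exists>l\<in>vecs (direct_sum X Y). (\<lambda>n. nrm (direct_sum X Y) (s n - l)) \<longlonglongrightarrow> 0"
      using a b tendsto_add[OF a(2) b(2)] by (intro bexI[of _ "(a, b)"]) auto
  qed
qed

lemma bounded_linear_op_fst:
  assumes X: "normed_space X" and Y: "normed_space Y"
  shows "bounded_linear_op (direct_sum X Y) X fst"
proof -
  interpret Y: carrier_normed_space Y using Y by unfold_locales
  show ?thesis
    by (rule bounded_linear_opI[where C = 1]) (auto simp: linear_op_def)
qed

lemma bounded_linear_op_snd:
  assumes X: "normed_space X" and Y: "normed_space Y"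
  shows "bounded_linear_op (direct_sum X Y) Y snd"
proof -
  interpret X: carrier_normed_space X using X by unfold_locales
  show ?thesis
    by (rule bounded_linear_opI[where C = 1]) (auto simp: linear_op_def)
qed

lemma bounded_linear_op_Pair:
  assumes Z: "normed_space Z" and T: "bounded_linear_op Z X T" and U: "bounded_linear_op Z Y U"
  shows "bounded_linear_op Z (direct_sum X Y) (\<lambda>z. (T z, U z))"
proof -
  obtain C where C: "\<And>x. x \<in> vecs Z \<Longrightarrow> nrm X (T x) \<le> C * nrm Z x"
    using bounded_linear_op_nonneg_bound[OF Z T] by metis
  obtain D where D: "\<And>x. x \<in> vecs Z \<Longrightarrow> nrm Y (U x) \<le> D * nrm Z x"
    using bounded_linear_op_nonneg_bound[OF Z U] by metis
  show ?thesis
  proof (rule bounded_linear_opI)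
    show "linear_op Z (direct_sum X Y) (\<lambda>z. (T z, U z))"
      using T U by (auto simp: bounded_linear_op_def linear_op_def)
    show "nrm (direct_sum X Y) (T z, U z) \<le> (C + D) * nrm Z z" if "z \<in> vecs Z" for z
      using C[OF that] D[OF that] by (simp add: distrib_right)
  qed
qed

lemma series_to_direct_sum:
  assumes X: "normed_space X" and Y: "normed_space Y"
    and u: "\<And>n. u n \<in> vecs X" and v: "\<And>n. v n \<in> vecs Y"
    and "series_to X u s" "series_to Y v t"
  shows "series_to (direct_sum X Y) (\<lambda>n. (u n, v n)) (s, t)"
proof -
  interpret X: carrier_normed_space X using X by unfold_locales
  interpret Y: carrier_normed_space Y using Y by unfold_locales
  interpret S: carrier_normed_space "direct_sum X Y"
    by unfold_locales (rule normed_space_direct_sum[OF X Y])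
  have "series_to (direct_sum X Y) (\<lambda>n. (u n, v n)) (s, t) \<longleftrightarrow>
      (s, t) \<in> vecs (direct_sum X Y) \<and>
      (\<lambda>N. nrm (direct_sum X Y) ((\<Sum>n<N. (u n, v n)) - (s, t))) \<longlonglongrightarrow> 0"
    by (rule S.series_to_iff) (simp add: u v)
  then show ?thesis
    using assms(5,6) X.series_to_iff[OF u] Y.series_to_iff[OF v]
    by (auto simp: fst_sum snd_sum intro!: tendsto_add_zero)
qed

section \<open>The sequence spaces\<close>

text \<open>Only an abstract isometric copy of the field inside the complex numbers is given; its range
  is closed, so limits taken in the complex numbers can be pulled back.\<close>

lemma real_or_complex_Cauchy_convergent:
  fixes s :: "nat \<Rightarrow> 'k::real_or_complex"
  assumes "Cauchy s"
  shows "convergent s"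
proof -
  obtain h :: "'k \<Rightarrow> complex" where add: "\<And>x y. h (x + y) = h x + h y"
    and iso: "\<And>x. norm (h x) = norm x" and range: "range h = \<real> \<or> range h = UNIV"
    using ex_isometric_iso_real_or_complex[where 'a = 'k] by auto
  have diff: "h (x - y) = h x - h y" for x y
    using add[of "x - y" y] by simp
  have dist: "dist (h x) (h y) = dist x y" for x y
    by (simp add: dist_norm iso flip: diff)
  have "Cauchy (\<lambda>n. h (s n))"
    using assms by (simp add: Cauchy_def dist)
  then obtain c where c: "(\<lambda>n. h (s n)) \<longlonglongrightarrow> c"
    using Cauchy_convergent convergent_def by blast
  have "closed (range h)"
    using range closed_complex_Reals by auto
  then have "c \<in> range h"
    by (rule closed_sequentially[OF _ _ c]) simp
  then obtain l where "c = h l"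
    by blast
  with c have "s \<longlonglongrightarrow> l"
    by (simp add: lim_sequentially dist)
  then show ?thesis
    by (auto simp: convergent_def)
qed

lemma lp_simps [simp]:
  "a \<in> vecs (lp p) \<longleftrightarrow> summable (\<lambda>n. norm (a n) powr p)"
  "smul (lp p) = (\<lambda>c a n. c * a n)"
  "nrm (lp p) a = (\<Sum>n. norm (a n) powr p) powr (1 / p)"
  by (simp_all add: lp_def)

text \<open>Convexity of the power function on the positive half-line is extended to the boundary point
  \<open>0\<close>, where it reduces to \<open>w\<^sup>p \<le> w\<close> for a weight \<open>w\<close> in the unit interval.\<close>

lemma powr_convex_combination:
  fixes x y u v p :: real
  assumes p: "1 \<le> p" and "0 \<le> x" "0 \<le> y" "0 \<le> u" "0 \<le> v" "u + v = 1"
  shows "(u * x + v * y) powr p \<le> u * x powr p + v * y powr p"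
proof -
  have scaled: "(w * z) powr p \<le> w * z powr p" if "0 \<le> w" "w \<le> 1" "0 \<le> z" for w z :: real
  proof -
    have "w powr p \<le> w"
      using powr_mono'[OF p that(1,2)] that by simp
    then show ?thesis
      using that by (simp add: powr_mult mult_right_mono)
  qed
  consider "x = 0" | "y = 0" | "0 < x" "0 < y"
    using assms by linarith
  then show ?thesis
  proof cases
    case 3
    then show ?thesis
      using powr_convex[OF p] assms by (auto simp: convex_on_def)
  qed (use scaled[of v y] scaled[of u x] assms in auto)
qed

definition unit_seq :: "nat \<Rightarrow> nat \<Rightarrow> 'k::real_or_complex" where
  "unit_seq n = (\<lambda>k. if k = n then 1 else 0)"

context
  fixes p :: real
  assumes p: "1 \<le> p"
begin

text \<open>This and the next lemma reduce membership and norm bounds to finite partial sums. Limits can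
  be passed coordinatewise through finite sums, which is how completeness is obtained below.\<close>

lemma lp_nrm_leI:
  fixes a :: "nat \<Rightarrow> 'k::real_or_complex"
  assumes C: "0 \<le> C" and le: "\<And>N. (\<Sum>n<N. norm (a n) powr p) \<le> C powr p"
  shows "a \<in> vecs (lp p)" and "nrm (lp p) a \<le> C"
proof -
  have s: "summable (\<lambda>n. norm (a n) powr p)"
    by (rule summableI_nonneg_bounded[OF _ le]) simp
  then show "a \<in> vecs (lp p)"
    by simp
  have "(\<Sum>n. norm (a n) powr p) powr (1 / p) \<le> (C powr p) powr (1 / p)"
    using p suminf_le_const[OF s le] by (intro powr_mono2 suminf_nonneg s) auto
  then show "nrm (lp p) a \<le> C"
    using p C by (simp add: powr_powr)
qed

lemma lp_partial_sum_le:
  fixes a :: "nat \<Rightarrow> 'k::real_or_complex"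
  assumes a: "a \<in> vecs (lp p)" and C: "nrm (lp p) a \<le> C"
  shows "(\<Sum>n<N. norm (a n) powr p) \<le> C powr p"
proof -
  have s: "summable (\<lambda>n. norm (a n) powr p)"
    using a by simp
  have "(\<Sum>n<N. norm (a n) powr p) \<le> (\<Sum>n. norm (a n) powr p)"
    by (rule sum_le_suminf[OF s]) auto
  also have "\<dots> = nrm (lp p) a powr p"
    using p suminf_nonneg[OF s] by (simp add: powr_powr)
  also have "\<dots> \<le> C powr p"
    using p C by (intro powr_mono2) auto
  finally show ?thesis .
qed

lemma lp_coordinate_le:
  fixes a :: "nat \<Rightarrow> 'k::real_or_complex"
  assumes a: "a \<in> vecs (lp p)"
  shows "norm (a n) \<le> nrm (lp p) a"
proof -
  have nonneg: "0 \<le> nrm (lp p) a"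
    by simp
  have "norm (a n) powr p \<le> (\<Sum>k<Suc n. norm (a k) powr p)"
    by (simp add: sum_nonneg)
  also have "\<dots> \<le> nrm (lp p) a powr p"
    by (rule lp_partial_sum_le[OF a order_refl])
  finally show ?thesis
    using p powr_less_mono2[of p "nrm (lp p) a" "norm (a n)"] nonneg by linarith
qed

text \<open>With \<open>A\<close> and \<open>B\<close> bounding the two norms, convexity of \<open>t \<mapsto> t\<^sup>p\<close> is applied to
  \<open>(s + t) / (A + B)\<close>, the convex combination of \<open>s / A\<close> and \<open>t / B\<close> with weights
  \<open>A / (A + B)\<close> and \<open>B / (A + B)\<close>; summing over the coordinates gives Minkowski's inequality.\<close>

lemma powr_add_le:
  fixes s t A B :: real
  assumes "0 \<le> s" "0 \<le> t" "0 < A" "0 < B"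
  shows "(s + t) powr p \<le>
    (A + B) powr p * (A / (A + B) * (s powr p / A powr p) + B / (A + B) * (t powr p / B powr p))"
proof -
  have "s + t = (A + B) * (A / (A + B) * (s / A) + B / (A + B) * (t / B))"
    using assms by (simp flip: add_divide_distrib)
  then have "(s + t) powr p = (A + B) powr p * (A / (A + B) * (s / A) + B / (A + B) * (t / B)) powr p"
    using assms by (simp add: powr_mult)
  also have "\<dots> \<le> (A + B) powr p *
      (A / (A + B) * (s / A) powr p + B / (A + B) * (t / B) powr p)"
    using assms by (intro mult_left_mono powr_convex_combination[OF p])
      (auto simp flip: add_divide_distrib)
  finally show ?thesis
    using assms by (simp add: powr_divide)
qed

lemma Minkowski_partial_sum:
  fixes a b :: "nat \<Rightarrow> 'k::real_or_complex"
  assumes A: "0 < A" "\<And>N. (\<Sum>n<N. norm (a n) powr p) \<le> A powr p"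
    and B: "0 < B" "\<And>N. (\<Sum>n<N. norm (b n) powr p) \<le> B powr p"
  shows "(\<Sum>n<N. norm (a n + b n) powr p) \<le> (A + B) powr p"
proof -
  let ?u = "A / (A + B)" and ?v = "B / (A + B)"
  have "(\<Sum>n<N. norm (a n + b n) powr p) \<le> (\<Sum>n<N. (norm (a n) + norm (b n)) powr p)"
    using p by (intro sum_mono powr_mono2 norm_triangle_ineq) auto
  also have "\<dots> \<le> (\<Sum>n<N. (A + B) powr p *
      (?u * (norm (a n) powr p / A powr p) + ?v * (norm (b n) powr p / B powr p)))"
    using A B by (intro sum_mono powr_add_le) auto
  also have "\<dots> = (A + B) powr p * (?u * ((\<Sum>n<N. norm (a n) powr p) / A powr p)
      + ?v * ((\<Sum>n<N. norm (b n) powr p) / B powr p))"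
    by (simp only: sum_distrib_left sum_divide_distrib flip: sum.distrib)
  also have "\<dots> \<le> (A + B) powr p * (?u * 1 + ?v * 1)"
    using A B by (intro mult_left_mono add_mono) auto
  also have "?u * 1 + ?v * 1 = 1"
    using A B by (simp flip: add_divide_distrib)
  finally show ?thesis
    by simp
qed

lemma Minkowski:
  fixes a b :: "nat \<Rightarrow> 'k::real_or_complex"
  assumes a: "a \<in> vecs (lp p)" and b: "b \<in> vecs (lp p)"
  shows "a + b \<in> vecs (lp p)" and "nrm (lp p) (a + b) \<le> nrm (lp p) a + nrm (lp p) b"
proof -
  \<comment> \<open>The slack \<open>e\<close> makes both radii positive, which avoids treating null sequences apart.\<close>
  have *: "a + b \<in> vecs (lp p) \<and> nrm (lp p) (a + b) \<le> nrm (lp p) a + nrm (lp p) b + e"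
    if "0 < e" for e
  proof -
    let ?A = "nrm (lp p) a + e / 2" and ?B = "nrm (lp p) b + e / 2"
    have pos: "0 < ?A" "0 < ?B"
      using that by (simp_all add: add_nonneg_pos)
    have "(\<Sum>n<N. norm ((a + b) n) powr p) \<le> (?A + ?B) powr p" for N
      using pos that
      by (simp only: plus_fun_apply)
        (intro Minkowski_partial_sum lp_partial_sum_le a b; simp)
    then have "a + b \<in> vecs (lp p)" "nrm (lp p) (a + b) \<le> ?A + ?B"
      using pos by (intro lp_nrm_leI[where C = "?A + ?B"]; simp del: lp_simps)+
    then show ?thesis
      by simp
  qed
  show "a + b \<in> vecs (lp p)"
    using *[of 1] by simp
  show "nrm (lp p) (a + b) \<le> nrm (lp p) a + nrm (lp p) b"
    by (rule field_le_epsilon) (use * in blast)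
qed

lemma normed_space_lp: "normed_space (lp p :: ('k::real_or_complex, _) nspace)"
proof -
  have V: "vector_space (smul (lp p :: ('k, _) nspace))"
    unfolding vector_space_def by (simp add: fun_eq_iff algebra_simps)
  then interpret V: vector_space "smul (lp p :: ('k, _) nspace)" .
  have smul: "(\<lambda>n. norm (c * a n) powr p) = (\<lambda>n. norm c powr p * norm (a n) powr p)"
    for c :: 'k and a :: "nat \<Rightarrow> 'k"
    by (simp add: norm_mult powr_mult)
  have "V.subspace (vecs (lp p))"
  proof (rule V.subspaceI)
    show "0 \<in> vecs (lp p :: ('k, _) nspace)"
      by simp
    show "a + b \<in> vecs (lp p)" if "a \<in> vecs (lp p)" "b \<in> vecs (lp p)" for a b :: "nat \<Rightarrow> 'k"
      using Minkowski(1)[OF that] .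
    show "smul (lp p) c a \<in> vecs (lp p)" if "a \<in> vecs (lp p)" for c and a :: "nat \<Rightarrow> 'k"
      using that by (simp add: smul summable_mult)
  qed
  moreover have "nrm (lp p) a = 0 \<longleftrightarrow> a = 0" if "a \<in> vecs (lp p)" for a :: "nat \<Rightarrow> 'k"
  proof
    assume "nrm (lp p) a = 0"
    then show "a = 0"
      using lp_coordinate_le[OF that] by (auto simp: fun_eq_iff simp del: lp_simps)
  qed simp
  moreover have "nrm (lp p) (smul (lp p) c a) = norm c * nrm (lp p) a"
    if "a \<in> vecs (lp p)" for c and a :: "nat \<Rightarrow> 'k"
    using p that suminf_nonneg[of "\<lambda>n. norm (a n) powr p"]
    by (simp add: smul suminf_mult powr_mult powr_powr)
  moreover have "0 \<le> nrm (lp p) a" for a :: "nat \<Rightarrow> 'k"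
    by simp
  ultimately show ?thesis
    unfolding normed_space_def using V Minkowski(2) by blast
qed

text \<open>The coordinatewise limit of a Cauchy sequence is its limit in norm: the bound on the partial
  sums of \<open>s k - s l\<close> survives \<open>l \<rightarrow> \<infinity>\<close>, uniformly in the number of terms.\<close>

lemma banach_space_lp: "banach_space (lp p :: ('k::real_or_complex, _) nspace)"
proof -
  interpret L: carrier_normed_space "lp p :: ('k, _) nspace"
    by unfold_locales (rule normed_space_lp)
  show ?thesis
    unfolding L.banach_space_iff
  proof (intro allI impI)
    fix s :: "nat \<Rightarrow> nat \<Rightarrow> 'k"
    assume s: "\<forall>k. s k \<in> vecs (lp p)"
      and c: "\<forall>e>0. \<exists>K. \<forall>k\<ge>K. \<forall>l\<ge>K. nrm (lp p) (s k - s l) < e"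
    have "Cauchy (\<lambda>k. s k n)" for n
    proof (rule CauchyI)
      fix e :: real assume "0 < e"
      with c obtain K where K: "\<forall>k\<ge>K. \<forall>l\<ge>K. nrm (lp p) (s k - s l) < e"
        by blast
      have "norm (s k n - s l n) < e" if "K \<le> k" "K \<le> l" for k l
      proof -
        have "norm ((s k - s l) n) \<le> nrm (lp p) (s k - s l)"
          by (intro lp_coordinate_le L.diff_vecs s[rule_format])
        also have "\<dots> < e"
          using K that by blast
        finally show ?thesis
          by simp
      qed
      then show "\<exists>K. \<forall>k\<ge>K. \<forall>l\<ge>K. norm (s k n - s l n) < e"
        by blast
    qed
    then have a: "(\<lambda>k. s k n) \<longlonglongrightarrow> lim (\<lambda>k. s k n)" for n
      using real_or_complex_Cauchy_convergent convergent_LIMSEQ_iff by blast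
    define a where "a n = lim (\<lambda>k. s k n)" for n
    note a = a[folded a_def]
    have close: "\<exists>K. \<forall>k\<ge>K. s k - a \<in> vecs (lp p) \<and> nrm (lp p) (s k - a) \<le> e"
      if "0 < e" for e
    proof -
      obtain K where K: "\<forall>k\<ge>K. \<forall>l\<ge>K. nrm (lp p) (s k - s l) < e"
        using c \<open>0 < e\<close> by blast
      have "(\<Sum>n<N. norm ((s k - a) n) powr p) \<le> e powr p" if "K \<le> k" for k N
      proof (rule LIMSEQ_le_const2)
        show "(\<lambda>l. \<Sum>n<N. norm ((s k - s l) n) powr p) \<longlonglongrightarrow> (\<Sum>n<N. norm ((s k - a) n) powr p)"
          unfolding minus_apply using p
          by (intro tendsto_sum tendsto_powr2 tendsto_norm tendsto_diff tendsto_const a) auto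
        have "(\<Sum>n<N. norm ((s k - s l) n) powr p) \<le> e powr p" if "K \<le> l" for l
        proof (rule lp_partial_sum_le)
          show "s k - s l \<in> vecs (lp p)"
            by (intro L.diff_vecs s[rule_format])
          show "nrm (lp p) (s k - s l) \<le> e"
            using K \<open>K \<le> k\<close> that by (intro less_imp_le) blast
        qed
        then show "\<exists>L. \<forall>l\<ge>L. (\<Sum>n<N. norm ((s k - s l) n) powr p) \<le> e powr p"
          by blast
      qed
      then show ?thesis
        using lp_nrm_leI[OF less_imp_le[OF that]] by blast
    qed
    obtain k where "s k - a \<in> vecs (lp p)"
      using close[OF zero_less_one] by blast
    from L.diff_vecs[OF spec[OF s, of k] this] have "a \<in> vecs (lp p)"
      by (simp del: lp_simps)
    moreover have "(\<lambda>k. nrm (lp p) (s k - a)) \<longlonglongrightarrow> 0"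
    proof (rule LIMSEQ_I)
      fix e :: real assume "0 < e"
      then obtain K where K: "\<forall>k\<ge>K. s k - a \<in> vecs (lp p) \<and> nrm (lp p) (s k - a) \<le> e / 2"
        using close[of "e / 2"] by auto
      have "norm (nrm (lp p) (s k - a) - 0) < e" if "K \<le> k" for k
      proof -
        have "nrm (lp p) (s k - a) \<le> e / 2" "0 \<le> nrm (lp p) (s k - a)"
          using K that L.nrm_nonneg by blast+
        then show ?thesis
          using \<open>0 < e\<close> by (simp del: lp_simps)
      qed
      then show "\<exists>K. \<forall>k\<ge>K. norm (nrm (lp p) (s k - a) - 0) < e"
        by blast
    qed
    ultimately show "\<exists>a\<in>vecs (lp p). (\<lambda>k. nrm (lp p) (s k - a)) \<longlonglongrightarrow> 0"
      by blast
  qed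
qed

lemma bounded_linear_op_lp_coordinate:
  "bounded_linear_op (lp p :: ('k::real_or_complex, _) nspace) scalars (\<lambda>a. a n)"
  by (rule bounded_linear_opI[where C = 1])
    (use lp_coordinate_le in \<open>auto simp: linear_op_def scalars_def\<close>)

lemma unit_seq_lp: "unit_seq n \<in> vecs (lp p)"
  by (simp, rule summable_finite[of "{n}"]) (auto simp: unit_seq_def)

text \<open>The \<open>p\<close>-th power of the distance from \<open>a\<close> to a partial sum is the tail of a convergent series.
  Finiteness of \<open>p\<close> matters here: the expansion fails in the space of bounded sequences.\<close>

lemma series_to_unit_seq:
  fixes a :: "nat \<Rightarrow> 'k::real_or_complex"
  assumes a: "a \<in> vecs (lp p)"
  shows "series_to (lp p) (\<lambda>n. smul (lp p) (a n) (unit_seq n)) a"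
proof -
  interpret L: carrier_normed_space "lp p :: ('k, _) nspace"
    by unfold_locales (rule normed_space_lp)
  let ?f = "\<lambda>n. norm (a n) powr p"
  have term_lp: "smul (lp p) (a n) (unit_seq n) \<in> vecs (lp p)" for n
    by (rule L.smul_vecs[OF unit_seq_lp])
  have partial: "(\<Sum>n<N. smul (lp p) (a n) (unit_seq n)) = (\<lambda>k. if k < N then a k else 0)" for N
    by (induction N) (auto simp: fun_eq_iff unit_seq_def less_Suc_eq)
  have sums: "?f sums suminf ?f"
    using a by (simp add: summable_sums)
  have tail: "(\<Sum>k. norm (((\<lambda>k. if k < N then a k else 0) - a) k) powr p) = suminf ?f - (\<Sum>k<N. ?f k)"
    for N
  proof -
    have "(\<lambda>k. if k \<in> {..<N} then 0 else ?f k) sums (suminf ?f + (\<Sum>k<N. 0 - ?f k))"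
      by (rule sums_If_finite_set'[OF sums]) auto
    moreover have "(\<lambda>k. norm (((\<lambda>k. if k < N then a k else 0) - a) k) powr p)
        = (\<lambda>k. if k \<in> {..<N} then 0 else ?f k)"
      by (auto simp: fun_eq_iff)
    ultimately show ?thesis
      by (simp add: sums_iff sum_negf)
  qed
  have lim: "(\<lambda>N. suminf ?f - (\<Sum>k<N. ?f k)) \<longlonglongrightarrow> 0"
    using sums tendsto_diff[OF tendsto_const, of _ "suminf ?f" _ "suminf ?f"]
    by (fastforce simp: sums_def)
  have nonneg: "0 \<le> suminf ?f - (\<Sum>k<N. ?f k)" for N
    using sum_le_suminf[of ?f "{..<N}"] a by simp
  have "(\<lambda>N. (suminf ?f - (\<Sum>k<N. ?f k)) powr (1 / p)) \<longlonglongrightarrow> 0"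
    by (rule tendsto_zero_powrI[OF lim tendsto_const always_eventually])
      (use p nonneg in simp_all)
  then have "(\<lambda>N. nrm (lp p) ((\<Sum>n<N. smul (lp p) (a n) (unit_seq n)) - a)) \<longlonglongrightarrow> 0"
    unfolding partial by (simp only: lp_simps tail)
  then show ?thesis
    using a L.series_to_iff[of "\<lambda>n. smul (lp p) (a n) (unit_seq n)", OF term_lp] by blast
qed

end

section \<open>Dilation of a p-approximate Schauder frame\<close>

locale p_frame =
  fixes p :: real
    and X :: "('k::real_or_complex, 'v::ab_group_add) nspace"
    and f :: "nat \<Rightarrow> 'v \<Rightarrow> 'k"
    and \<tau> :: "nat \<Rightarrow> 'v"
  assumes p: "1 \<le> p"
    and banach_X: "banach_space X"
    and p_ASF: "p_ASF p X f \<tau>"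
begin

abbreviation "L \<equiv> (lp p :: ('k, nat \<Rightarrow> 'k) nspace)"
abbreviation "analysis \<equiv> analysis_op f"
abbreviation "synthesis \<equiv> synthesis_op X \<tau>"
abbreviation "S \<equiv> frame_op X f \<tau>"
abbreviation "S_inv \<equiv> inverse_op X S"

lemma normed_X: "normed_space X"
  using banach_X by (simp add: banach_space_def)

sublocale X: carrier_normed_space X
  by unfold_locales (rule normed_X)

lemma normed_L: "normed_space L"
  by (rule normed_space_lp[OF p])

sublocale L: carrier_normed_space L
  by unfold_locales (rule normed_L)

lemma
  shows \<tau>_vecs: "\<tau> n \<in> vecs X"
    and bounded_S: "bounded_linear_op X X S"
    and bij_S: "bij_betw S (vecs X) (vecs X)"
    and bounded_S_inv: "bounded_linear_op X X S_inv"
    and bounded_analysis: "bounded_linear_op X L analysis"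
    and bounded_synthesis: "bounded_linear_op L X synthesis"
    and series_converges_synthesis:
      "a \<in> vecs L \<Longrightarrow> series_converges X (\<lambda>n. smul X (a n) (\<tau> n))"
  using p_ASF by (auto simp: p_ASF_def ASF_def bounded_invertible_op_def simp del: lp_simps)

lemmas S_vecs = linear_opD(1)[OF bounded_linear_op_linear[OF bounded_S]]
lemmas S_inv_vecs = linear_opD(1)[OF bounded_linear_op_linear[OF bounded_S_inv]]
lemmas analysis_vecs = linear_opD(1)[OF bounded_linear_op_linear[OF bounded_analysis]]
lemmas synthesis_vecs = linear_opD(1)[OF bounded_linear_op_linear[OF bounded_synthesis]]

lemma S_inv_S: "x \<in> vecs X \<Longrightarrow> S_inv (S x) = x"
  unfolding inverse_op_def using bij_S by (intro inv_into_f_f) (auto simp: bij_betw_def)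

lemma S_S_inv: "x \<in> vecs X \<Longrightarrow> S (S_inv x) = x"
  unfolding inverse_op_def using bij_S by (intro f_inv_into_f) (auto simp: bij_betw_def)

lemma synthesis_analysis: "synthesis (analysis x) = S x"
  by (simp add: synthesis_op_def analysis_op_def frame_op_def)

lemma series_to_synthesis:
  "a \<in> vecs L \<Longrightarrow> series_to X (\<lambda>n. smul X (a n) (\<tau> n)) (synthesis a)"
  unfolding synthesis_op_def
  by (intro X.series_to_series_sum series_converges_synthesis X.smul_vecs \<tau>_vecs)

text \<open>\<open>analysis \<circ> S_inv \<circ> synthesis\<close> is a projection of the sequence space with the same kernel as
  \<open>synthesis\<close>; \<open>residual\<close> is the complementary projection, onto that kernel.\<close>

definition residual :: "(nat \<Rightarrow> 'k) \<Rightarrow> nat \<Rightarrow> 'k" where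
  "residual a = a - analysis (S_inv (synthesis a))"

definition kernel :: "('k, nat \<Rightarrow> 'k) nspace" where
  "kernel = kernel_nspace L synthesis"

lemma kernel_simps [simp]:
  "vecs kernel = {a \<in> vecs L. synthesis a = 0}" "smul kernel = smul L" "nrm kernel = nrm L"
  by (simp_all add: kernel_def)

lemma banach_kernel: "banach_space kernel"
  unfolding kernel_def
  by (rule banach_space_kernel[OF banach_space_lp[OF p] normed_X bounded_synthesis])

lemma normed_kernel: "normed_space kernel"
  using banach_kernel by (simp add: banach_space_def)

sublocale K: carrier_normed_space kernel
  by unfold_locales (rule normed_kernel)

text \<open>\<open>synthesis \<circ> analysis \<circ> S_inv\<close> is the identity, so \<open>a\<close> and its image under
  \<open>analysis \<circ> S_inv \<circ> synthesis\<close> have the same synthesis.\<close>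

lemma synthesis_residual:
  assumes "a \<in> vecs L"
  shows "synthesis (residual a) = 0"
  using assms
  by (simp add: residual_def linear_op_diff[OF normed_L bounded_linear_op_linear[OF bounded_synthesis]]
      synthesis_analysis S_S_inv analysis_vecs S_inv_vecs synthesis_vecs del: lp_simps)

lemma bounded_residual: "bounded_linear_op L kernel residual"
proof -
  have "bounded_linear_op L L (\<lambda>a. analysis (S_inv (synthesis a)))"
    by (intro bounded_linear_op_compose[OF normed_L normed_X _ bounded_analysis]
        bounded_linear_op_compose[OF normed_L normed_X bounded_synthesis bounded_S_inv])
  from bounded_linear_op_diff[OF normed_L normed_L bounded_linear_op_id this]
  have "bounded_linear_op L L residual"
    by (simp add: residual_def[abs_def] del: lp_simps)
  then show ?thesis
    unfolding kernel_def by (rule bounded_linear_op_into_kernel) (rule synthesis_residual)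
qed

lemmas residual_vecs = linear_opD(1)[OF bounded_linear_op_linear[OF bounded_residual]]

definition X1 :: "('k, 'v \<times> (nat \<Rightarrow> 'k)) nspace" where
  "X1 = direct_sum X kernel"

definition g :: "nat \<Rightarrow> 'v \<times> (nat \<Rightarrow> 'k) \<Rightarrow> 'k" where
  "g n z = f n (fst z) + snd z n"

definition \<omega> :: "nat \<Rightarrow> 'v \<times> (nat \<Rightarrow> 'k)" where
  "\<omega> n = (\<tau> n, residual (unit_seq n))"

lemma X1_simps [simp]:
  "vecs X1 = vecs X \<times> vecs kernel"
  "smul X1 c z = (smul X c (fst z), smul kernel c (snd z))"
  "nrm X1 z = nrm X (fst z) + nrm kernel (snd z)"
  by (simp_all add: X1_def)

lemma banach_X1: "banach_space X1"
  unfolding X1_def by (rule banach_space_direct_sum[OF banach_X banach_kernel])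

lemma normed_X1: "normed_space X1"
  using banach_X1 by (simp add: banach_space_def)

sublocale X1: carrier_normed_space X1
  by unfold_locales (rule normed_X1)

lemma \<omega>_vecs: "\<omega> n \<in> vecs X1"
  unfolding \<omega>_def X1_simps by (intro SigmaI \<tau>_vecs residual_vecs unit_seq_lp[OF p])

lemma analysis_op_g: "analysis_op g z = analysis (fst z) + snd z"
  by (simp add: analysis_op_def g_def fun_eq_iff)

lemma bounded_analysis_op_g: "bounded_linear_op X1 L (analysis_op g)"
proof -
  have "bounded_linear_op X1 L (\<lambda>z. analysis (fst z) + snd z)"
  proof (rule bounded_linear_op_add[OF normed_X1 normed_L])
    show "bounded_linear_op X1 L (\<lambda>z. analysis (fst z))"
      by (rule bounded_linear_op_compose[OF normed_X1 normed_X _ bounded_analysis])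
        (simp add: X1_def bounded_linear_op_fst[OF normed_X normed_kernel])
    show "bounded_linear_op X1 L snd"
    proof (rule bounded_linear_op_compose[OF normed_X1 normed_kernel])
      show "bounded_linear_op X1 kernel snd"
        by (simp add: X1_def bounded_linear_op_snd[OF normed_X normed_kernel])
      show "bounded_linear_op kernel L (\<lambda>y. y)"
        by (simp add: kernel_def bounded_linear_op_kernel_inclusion)
    qed
  qed
  then show ?thesis
    by (simp add: analysis_op_g[abs_def] del: lp_simps)
qed

lemmas analysis_op_g_vecs = linear_opD(1)[OF bounded_linear_op_linear[OF bounded_analysis_op_g]]

lemma g_dual: "g n \<in> dual X1"
proof -
  have "bounded_linear_op X1 scalars (\<lambda>z. analysis_op g z n)"
    by (rule bounded_linear_op_compose[OF normed_X1 normed_L bounded_analysis_op_g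
          bounded_linear_op_lp_coordinate[OF p]])
  then show ?thesis
    by (simp add: dual_def analysis_op_def)
qed

text \<open>The coordinate vectors expand every sequence of the sequence space, so applying \<open>residual\<close>
  to this expansion gives the second component of the synthesis.\<close>

lemma series_to_\<omega>:
  assumes a: "a \<in> vecs L"
  shows "series_to X1 (\<lambda>n. smul X1 (a n) (\<omega> n)) (synthesis a, residual a)"
proof -
  have term_L: "smul L (a n) (unit_seq n) \<in> vecs L" for n
    by (rule L.smul_vecs[OF unit_seq_lp[OF p]])
  have "series_to kernel (\<lambda>n. residual (smul L (a n) (unit_seq n))) (residual a)"
    by (rule series_to_bounded_linear_op[OF normed_L normed_kernel bounded_residual term_L
          series_to_unit_seq[OF p a]])
  then have "series_to kernel (\<lambda>n. smul kernel (a n) (residual (unit_seq n))) (residual a)"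
    by (simp only: linear_opD(3)[OF bounded_linear_op_linear[OF bounded_residual] unit_seq_lp[OF p]])
  from series_to_direct_sum[OF normed_X normed_kernel X.smul_vecs[OF \<tau>_vecs]
      K.smul_vecs[OF residual_vecs[OF unit_seq_lp[OF p]]] series_to_synthesis[OF a] this]
  show ?thesis
    by (simp only: X1_simps \<omega>_def fst_conv snd_conv X1_def[symmetric])
qed

lemma synthesis_op_\<omega>:
  "a \<in> vecs L \<Longrightarrow> synthesis_op X1 \<omega> a = (synthesis a, residual a)"
  unfolding synthesis_op_def[of X1]
  by (rule X1.series_sum_eqI[OF X1.smul_vecs[OF \<omega>_vecs] series_to_\<omega>])

lemma bounded_synthesis_op_\<omega>: "bounded_linear_op L X1 (synthesis_op X1 \<omega>)"
proof (rule bounded_linear_op_cong[OF normed_L])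
  show "bounded_linear_op L X1 (\<lambda>a. (synthesis a, residual a))"
    unfolding X1_def by (rule bounded_linear_op_Pair[OF normed_L bounded_synthesis bounded_residual])
qed (simp only: synthesis_op_\<omega>)

text \<open>The mixed terms vanish: \<open>snd z\<close> contributes nothing to the synthesis because it lies in the
  kernel, and \<open>analysis (fst z)\<close> has residual \<open>0\<close> because \<open>S_inv \<circ> synthesis\<close> is a left inverse of
  \<open>analysis\<close>.\<close>

lemma frame_op_X1:
  assumes "z \<in> vecs X1"
  shows "frame_op X1 g \<omega> z = (S (fst z), snd z)"
proof -
  have x: "fst z \<in> vecs X" and y: "snd z \<in> vecs L" "synthesis (snd z) = 0"
    using assms by auto
  let ?a = "analysis (fst z) + snd z"
  have "frame_op X1 g \<omega> z = synthesis_op X1 \<omega> (analysis_op g z)"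
    by (simp add: frame_op_def synthesis_op_def analysis_op_def)
  also have "\<dots> = (synthesis ?a, residual ?a)"
    using synthesis_op_\<omega>[OF analysis_op_g_vecs[OF assms]] by (simp only: analysis_op_g)
  also have syn: "synthesis ?a = S (fst z)"
    using linear_opD(2)[OF bounded_linear_op_linear[OF bounded_synthesis] analysis_vecs[OF x] y(1)]
    by (simp add: y(2) synthesis_analysis)
  also have "residual ?a = snd z"
    by (simp add: residual_def syn S_inv_S x)
  finally show ?thesis .
qed

lemma bij_frame_op_X1: "bij_betw (frame_op X1 g \<omega>) (vecs X1) (vecs X1)"
proof (rule bij_betwI[where g = "\<lambda>z. (S_inv (fst z), snd z)"])
qed (auto simp: frame_op_X1 S_vecs S_inv_vecs S_inv_S S_S_inv simp del: lp_simps)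

lemma inverse_frame_op_X1:
  assumes "z \<in> vecs X1"
  shows "inverse_op X1 (frame_op X1 g \<omega>) z = (S_inv (fst z), snd z)"
  unfolding inverse_op_def[of X1]
proof (rule inv_into_f_eq)
  show "inj_on (frame_op X1 g \<omega>) (vecs X1)"
    using bij_frame_op_X1 by (simp add: bij_betw_def)
qed (use assms in \<open>auto simp: frame_op_X1 S_inv_vecs S_S_inv simp del: lp_simps\<close>)

lemma bounded_linear_op_X1_map_fst:
  assumes "bounded_linear_op X X T"
  shows "bounded_linear_op X1 X1 (\<lambda>z. (T (fst z), snd z))"
proof -
  have "bounded_linear_op X1 X (\<lambda>z. T (fst z))"
    by (rule bounded_linear_op_compose[OF normed_X1 normed_X _ assms])
      (simp add: X1_def bounded_linear_op_fst[OF normed_X normed_kernel])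
  moreover have "bounded_linear_op X1 kernel snd"
    by (simp add: X1_def bounded_linear_op_snd[OF normed_X normed_kernel])
  ultimately show ?thesis
    using bounded_linear_op_Pair[OF normed_X1, of X _ kernel snd] by (simp add: X1_def)
qed

text \<open>The Riesz property is the decomposition of \<open>a\<close> into its image under
  \<open>analysis \<circ> S_inv \<circ> synthesis\<close>, recovered from the first component of the new space, and its
  residual, stored in the second.\<close>

lemma p_approx_Riesz_basis_X1: "p_approx_Riesz_basis p X1 g \<omega>"
proof -
  have "bounded_linear_op X1 X1 (frame_op X1 g \<omega>)"
    by (rule bounded_linear_op_cong[OF normed_X1 _ bounded_linear_op_X1_map_fst[OF bounded_S]])
      (simp only: frame_op_X1)
  moreover have "bounded_linear_op X1 X1 (inverse_op X1 (frame_op X1 g \<omega>))"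
    by (rule bounded_linear_op_cong[OF normed_X1 _ bounded_linear_op_X1_map_fst[OF bounded_S_inv]])
      (simp only: inverse_frame_op_X1)
  moreover have conv: "series_converges X1 (\<lambda>n. smul X1 (a n) (\<omega> n))" if "a \<in> vecs L" for a
    using series_to_\<omega>[OF that] unfolding series_converges_def by blast
  moreover have "series_converges X1 (\<lambda>n. smul X1 (g n z) (\<omega> n))" if "z \<in> vecs X1" for z
    using conv[OF analysis_op_g_vecs[OF that]] by (simp only: analysis_op_def)
  ultimately have "p_ASF p X1 g \<omega>"
    unfolding p_ASF_def ASF_def bounded_invertible_op_def
    using g_dual \<omega>_vecs bij_frame_op_X1 bounded_analysis_op_g bounded_synthesis_op_\<omega> by blast
  moreover have
    "analysis_op g (inverse_op X1 (frame_op X1 g \<omega>) (synthesis_op X1 \<omega> a)) = a"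
    if a: "a \<in> vecs L" for a
  proof -
    have "inverse_op X1 (frame_op X1 g \<omega>) (synthesis_op X1 \<omega> a) = (S_inv (synthesis a), residual a)"
      using inverse_frame_op_X1[of "(synthesis a, residual a)"] synthesis_vecs[OF a] residual_vecs[OF a]
      by (simp add: synthesis_op_\<omega>[OF a] del: lp_simps)
    then show ?thesis
      by (simp add: analysis_op_g residual_def)
  qed
  ultimately show ?thesis
    by (simp add: p_approx_Riesz_basis_def del: lp_simps)
qed

lemma isometric_embedding_X1: "isometric_embedding X X1 (\<lambda>x. (x, 0))"
proof -
  have "0 \<in> vecs kernel" "nrm kernel 0 = 0" "smul kernel c 0 = 0" for c
    by (rule K.zero_vecs K.nrm_zero K.scale_zero_right)+
  then show ?thesis
    unfolding isometric_embedding_def linear_op_def X1_simps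
    by (simp add: image_subset_iff del: kernel_simps)
qed

lemma projection_onto_X1: "projection_onto X1 ((\<lambda>x. (x, 0)) ` vecs X) (\<lambda>z. (fst z, 0))"
proof -
  have zero: "0 \<in> vecs kernel" "nrm kernel 0 = 0" "smul kernel c 0 = 0" for c
    by (rule K.zero_vecs K.nrm_zero K.scale_zero_right)+
  have "bounded_linear_op X1 X1 (\<lambda>z. (fst z, 0))"
  proof (rule bounded_linear_opI[where C = 1])
    show "linear_op X1 X1 (\<lambda>z. (fst z, 0))"
      unfolding linear_op_def X1_simps
      by (auto simp: zero simp del: kernel_simps)
    show "nrm X1 (fst z, 0) \<le> 1 * nrm X1 z" if "z \<in> vecs X1" for z
    proof -
      have "0 \<le> nrm kernel (snd z)"
        using that by (intro K.nrm_nonneg) auto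
      then show ?thesis
        by (simp add: zero del: kernel_simps)
    qed
  qed
  moreover have "(\<lambda>z. (fst z, 0 :: nat \<Rightarrow> 'k)) ` vecs X1 = (\<lambda>x. (x, 0)) ` vecs X"
  proof
    show "(\<lambda>x. (x, 0 :: nat \<Rightarrow> 'k)) ` vecs X \<subseteq> (\<lambda>z. (fst z, 0)) ` vecs X1"
    proof
      fix z assume "z \<in> (\<lambda>x. (x, 0 :: nat \<Rightarrow> 'k)) ` vecs X"
      then have "z \<in> vecs X1" "z = (fst z, 0)"
        using zero(1) by (auto simp del: kernel_simps)
      then show "z \<in> (\<lambda>z. (fst z, 0)) ` vecs X1"
        by (rule rev_image_eqI)
    qed
  qed auto
  ultimately show ?thesis
    by (simp add: projection_onto_def)
qed

end

theorem theorem2p9: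
  fixes p :: real
    and X :: "('k::real_or_complex, 'v::ab_group_add) nspace"
    and f :: "nat \<Rightarrow> 'v \<Rightarrow> 'k"
    and \<tau> :: "nat \<Rightarrow> 'v"
  assumes "1 \<le> p"
    and "banach_space X"
    and "separable_nspace X"
    and "p_ASF p X f \<tau>"
  shows "\<exists>(X1 :: ('k, 'v \<times> (nat \<Rightarrow> 'k)) nspace) J P g \<omega>.
           banach_space X1 \<and>
           isometric_embedding X X1 J \<and>
           projection_onto X1 (J ` vecs X) P \<and>
           p_approx_Riesz_basis p X1 g \<omega> \<and>
           (\<forall>n. \<forall>x\<in>vecs X. f n x = g n (P (J x))) \<and>
           (\<forall>n. J (\<tau> n) = P (\<omega> n))"
proof -
  interpret D: p_frame p X f \<tau>
    using assms by unfold_locales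
  have "\<forall>n. \<forall>x\<in>vecs X. f n x = D.g n (fst (x, 0 :: nat \<Rightarrow> 'k), 0)"
    by (simp add: D.g_def)
  moreover have "\<forall>n. (\<tau> n, 0) = (fst (D.\<omega> n), 0 :: nat \<Rightarrow> 'k)"
    by (simp add: D.\<omega>_def)
  ultimately show ?thesis
    using D.banach_X1 D.isometric_embedding_X1 D.projection_onto_X1 D.p_approx_Riesz_basis_X1
    by blast
qed

end
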